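(* Let $s_1,\dots,s_N$ be solution candidates with success probabilities $p_i\in[0,1]$ and execution times $t_i>0$, ordered so that $\frac{p_1}{t_1}\ge\frac{p_2}{t_2}\ge\dots\ge\frac{p_N}{t_N}$. Let $k,n\ge1$ be integers with $k+n\le N$ and $p_k\neq 1$. Then exchanging the $k$-th and $(k+n)$-th candidates in the optimal strategy $s_1,\dots,s_N$ increases the expected problem solving time by at most $$EXC=q_1+q_2+q_3,$$ where $$q_1=T_{k-1}Q_{k-1}(p_{k+n}-p_k)+Q_{k-1}(t_{k+n}p_{k+n}-t_kp_k),$$ $$q_2=\sum_{l=k+1}^{k+n-1}Q_{l-1}\,p_l\left(T_l\cdot\frac{p_k-p_{k+n}}{1-p_k}+(t_{k+n}-t_k)\frac{1-p_{k+n}}{1-p_k}\right),$$ $$q_3=T_{k+n}\,Q_{k+n-1}\,\frac{p_k-p_{k+n}}{1-p_k}.$$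
   Context: $T_m=\sum_{i=1}^m t_i$ and $Q_m=\prod_{i=1}^m(1-p_i)$, with empty sums equal to $0$ and empty products equal to $1$. Successes of different candidates are independent, and each candidate is tried at most once. A strategy is an ordering of the candidates, i.e. a permutation $\tau$ of $\{1,\dots,N\}$; its expected problem solving time (time spent before either finding a solution or discovering that no candidate works) is $$E(\tau)=\sum_{k=1}^{N}\Big(\sum_{l=1}^{k} t_{\tau(l)}\Big)\Big(\prod_{j=1}^{k-1}(1-p_{\tau(j)})\Big)p_{\tau(k)}+\Big(\sum_{l=1}^{N}t_l\Big)\prod_{j=1}^{N}(1-p_j).$$ The increase is $E$ of the order with positions $k$ and $k+n$ exchanged (all others unchanged) minus $E$ of the order $s_1,\dots,s_N$. *)

theory Defs
  imports Complex_Main "HOL-Combinatorics.Permutations"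
begin

text \<open>Candidates are the indices \<open>1, \<dots>, N\<close>; candidate \<open>i\<close> has execution time \<open>t i\<close> and
  success probability \<open>p i\<close>. Values of \<open>t\<close> and \<open>p\<close> outside \<open>{1..N}\<close> play no role.\<close>

definition T :: "(nat \<Rightarrow> real) \<Rightarrow> nat \<Rightarrow> real" where
  "T t m = (\<Sum>i=1..m. t i)"

definition Q :: "(nat \<Rightarrow> real) \<Rightarrow> nat \<Rightarrow> real" where
  "Q p m = (\<Prod>i=1..m. 1 - p i)"

text \<open>A strategy is a permutation \<open>\<tau>\<close> of \<open>{1..N}\<close>, where \<open>\<tau> k\<close> is the candidate tried at
  position \<open>k\<close>.\<close>

definition strategy :: "nat \<Rightarrow> (nat \<Rightarrow> nat) \<Rightarrow> bool" where
  "strategy N \<tau> \<longleftrightarrow> \<tau> permutes {1..N}"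

text \<open>The first summand accounts for the first success occurring at position \<open>k\<close> (successes of
  different candidates being independent), the second one for all candidates failing.\<close>

definition expected_time ::
    "nat \<Rightarrow> (nat \<Rightarrow> real) \<Rightarrow> (nat \<Rightarrow> real) \<Rightarrow> (nat \<Rightarrow> nat) \<Rightarrow> real" where
  "expected_time N t p \<tau> =
     (\<Sum>k=1..N. (\<Sum>l=1..k. t (\<tau> l)) * (\<Prod>j=1..k-1. 1 - p (\<tau> j)) * p (\<tau> k))
     + (\<Sum>l=1..N. t l) * (\<Prod>j=1..N. 1 - p j)"

text \<open>Precomposition with the transposition swaps positions, not candidates.\<close>

definition exchange :: "nat \<Rightarrow> nat \<Rightarrow> (nat \<Rightarrow> nat) \<Rightarrow> nat \<Rightarrow> nat" where
  "exchange i j \<tau> = \<tau> \<circ> transpose i j"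

lemma strategy_id: "strategy N id"
  by (simp add: strategy_def permutes_id)

lemma strategy_exchange:
  assumes "strategy N \<tau>" "i \<in> {1..N}" "j \<in> {1..N}"
  shows "strategy N (exchange i j \<tau>)"
  using assms unfolding strategy_def exchange_def
  by (intro permutes_compose permutes_swap_id)

definition q1 :: "(nat \<Rightarrow> real) \<Rightarrow> (nat \<Rightarrow> real) \<Rightarrow> nat \<Rightarrow> nat \<Rightarrow> real" where
  "q1 t p k n = T t (k - 1) * Q p (k - 1) * (p (k + n) - p k)
     + Q p (k - 1) * (t (k + n) * p (k + n) - t k * p k)"

definition q2 :: "(nat \<Rightarrow> real) \<Rightarrow> (nat \<Rightarrow> real) \<Rightarrow> nat \<Rightarrow> nat \<Rightarrow> real" where
  "q2 t p k n = (\<Sum>l=k+1..k+n-1. Q p (l - 1) * p l *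
     (T t l * ((p k - p (k + n)) / (1 - p k))
      + (t (k + n) - t k) * ((1 - p (k + n)) / (1 - p k))))"

definition q3 :: "(nat \<Rightarrow> real) \<Rightarrow> (nat \<Rightarrow> real) \<Rightarrow> nat \<Rightarrow> nat \<Rightarrow> real" where
  "q3 t p k n = T t (k + n) * Q p (k + n - 1) * ((p k - p (k + n)) / (1 - p k))"

definition EXC :: "(nat \<Rightarrow> real) \<Rightarrow> (nat \<Rightarrow> real) \<Rightarrow> nat \<Rightarrow> nat \<Rightarrow> real" where
  "EXC t p k n = q1 t p k n + q2 t p k n + q3 t p k n"

end

theory Submission imports Defs begin

text \<open>
  The bound is in fact an identity, which holds because the exchange acts on the expected time
  one position at a time. Put \<open>b = k + n\<close>. The summand of position \<open>l\<close> depends on the order only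
  through the candidate tried at \<open>l\<close>, the \<^emph>\<open>set\<close> of candidates tried up to \<open>l\<close> (elapsed time), and
  the set of those tried up to \<open>l - 1\<close> (probability that all of them failed). These sets change
  exactly when the prefix contains position \<open>k\<close> but not position \<open>b\<close>; then candidate \<open>k\<close> is
  replaced by candidate \<open>b\<close>, so the elapsed time grows by \<open>t b - t k\<close> and the failure probability
  is multiplied by \<open>(1 - p b) / (1 - p k)\<close>. This is where \<open>p k \<noteq> 1\<close> is needed.

  Hence nothing changes before position \<open>k\<close> or after position \<open>b\<close>. The change at position \<open>k\<close> is
  \<open>q1\<close>, the changes strictly in between are the summands of \<open>q2\<close>, and the change at position \<open>b\<close>
  is \<open>q3\<close>, because \<open>(1 - p b) / (1 - p k) * p k - p b = (p k - p b) / (1 - p k)\<close>. The time spent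
  when every candidate fails is the same for all orders.
\<close>

lemma (in comm_monoid_set) prefix_transpose_unchanged:
  fixes i j m :: nat
  assumes "1 \<le> i" "i < j" "m < i \<or> j \<le> m"
  shows "F (\<lambda>l. g (transpose i j l)) {1..m} = F g {1..m}"
  using assms(3)
proof
  assume "m < i"
  then show ?thesis
    using assms(2) by (intro cong) (auto simp: transpose_def)
next
  assume "j \<le> m"
  then have "transpose i j permutes {1..m}"
    using assms by (intro permutes_swap_id) auto
  from permute[OF this, of g] show ?thesis by (simp add: comp_def)
qed

text \<open>In an arbitrary commutative monoid the replaced factor need not be cancellable, so it appears
  on the left. Sums give the elapsed time, products the failure probability.\<close>

lemma (in comm_monoid_set) prefix_transpose_replaced:
  fixes i j m :: nat
  assumes "1 \<le> i" "i \<le> m" "m < j"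
  shows "f (F (\<lambda>l. g (transpose i j l)) {1..m}) (g i) = f (F g {1..m}) (g j)"
proof -
  have i: "i \<in> {1..m}" and fin: "finite {1..m}"
    using assms by auto
  have "F (\<lambda>l. g (transpose i j l)) ({1..m} - {i}) = F g ({1..m} - {i})"
    using assms by (intro cong) (auto simp: transpose_def)
  then show ?thesis
    using remove[OF fin i, of g] remove[OF fin i, of "\<lambda>l. g (transpose i j l)"]
    by (simp add: ac_simps)
qed

theorem expected_time_exchange_eq_EXC:
  fixes N k n :: nat and p t :: "nat \<Rightarrow> real"
  assumes "k \<ge> 1" "n \<ge> 1" "k + n \<le> N" "p k \<noteq> 1"
  shows "expected_time N t p (exchange k (k + n) id) - expected_time N t p id = EXC t p k n"
proof -
  define b where "b = k + n"
  have kb: "1 \<le> k" "k < b" "b \<le> N"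
    using assms by (auto simp: b_def)
  have pk: "1 - p k \<noteq> 0"
    using assms by simp
  define s where "s = transpose k b"
  have s: "s k = b" "s b = k" "\<And>l. l \<noteq> k \<Longrightarrow> l \<noteq> b \<Longrightarrow> s l = l"
    by (auto simp: s_def transpose_def)
  define T' where "T' m = (\<Sum>l=1..m. t (s l))" for m
  define Q' where "Q' m = (\<Prod>j=1..m. 1 - p (s j))" for m
  define d where "d l = T' l * Q' (l - 1) * p (s l) - T t l * Q p (l - 1) * p l" for l

  have T'_out: "T' m = T t m" if "m < k \<or> b \<le> m" for m
    unfolding T'_def T_def s_def using kb that by (intro sum.prefix_transpose_unchanged) auto
  have Q'_out: "Q' m = Q p m" if "m < k \<or> b \<le> m" for m
    unfolding Q'_def Q_def s_def
    using kb that prod.prefix_transpose_unchanged[of k b m "\<lambda>l. 1 - p l"] by auto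
  have T'_in: "T' m = T t m + (t b - t k)" if "k \<le> m" "m < b" for m
    unfolding T'_def T_def s_def using kb that sum.prefix_transpose_replaced[of k m b t] by simp
  have Q'_in: "Q' m = Q p m * ((1 - p b) / (1 - p k))" if "k \<le> m" "m < b" for m
    unfolding Q'_def Q_def s_def
    using kb that pk prod.prefix_transpose_replaced[of k m b "\<lambda>l. 1 - p l"]
    by (simp add: field_simps)

  have d_out: "d l = 0" if "l < k \<or> b < l" for l
  proof -
    have "T' l = T t l" "Q' (l - 1) = Q p (l - 1)" "s l = l"
      using that kb by (auto intro!: T'_out Q'_out s(3))
    then show ?thesis by (simp add: d_def)
  qed
  have d_k: "d k = q1 t p k n"
  proof -
    have "T t k = T t (k - 1) + t k"
      using kb by (cases k) (auto simp: T_def)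
    then show ?thesis
      using kb T'_in[of k] Q'_out[of "k - 1"]
      by (simp add: d_def q1_def s b_def[symmetric] algebra_simps)
  qed
  have ratio: "(1 - p b) / (1 - p k) = 1 + (p k - p b) / (1 - p k)"
    using pk by (simp add: field_simps)
  have d_between: "d l = Q p (l - 1) * p l *
      (T t l * ((p k - p b) / (1 - p k)) + (t b - t k) * ((1 - p b) / (1 - p k)))"
    if "l \<in> {k+1..b-1}" for l
  proof -
    have l: "T' l = T t l + (t b - t k)" "Q' (l - 1) = Q p (l - 1) * ((1 - p b) / (1 - p k))"
        "s l = l"
      using that kb T'_in[of l] Q'_in[of "l - 1"] s(3)[of l] by auto
    show ?thesis
      unfolding d_def l ratio by (simp only: algebra_simps)
  qed
  have d_b: "d b = q3 t p k n"
  proof -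
    have "(1 - p b) / (1 - p k) * p k - p b = (p k - p b) / (1 - p k)"
      using pk by (simp add: field_simps)
    then have "T t b * Q p (b - 1) * ((1 - p b) / (1 - p k) * p k - p b) = q3 t p k n"
      by (simp add: q3_def b_def)
    moreover have "T' b = T t b" "Q' (b - 1) = Q p (b - 1) * ((1 - p b) / (1 - p k))"
      using kb T'_out[of b] Q'_in[of "b - 1"] by auto
    ultimately show ?thesis
      by (simp add: d_def s algebra_simps)
  qed

  have "expected_time N t p (exchange k (k + n) id) - expected_time N t p id = (\<Sum>l=1..N. d l)"
    by (simp add: expected_time_def exchange_def d_def T'_def Q'_def T_def Q_def s_def b_def
        sum_subtractf)
  also have "\<dots> = (\<Sum>l=k..b. d l)"
    using kb by (intro sum.mono_neutral_right) (auto intro!: d_out)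
  also have "{k..b} = insert k (insert b {k+1..b-1})"
    using kb by auto
  also have "sum d \<dots> = d k + (d b + (\<Sum>l=k+1..b-1. d l))"
    using kb by simp
  also have "(\<Sum>l=k+1..b-1. d l) = q2 t p k n"
    unfolding q2_def b_def[symmetric] by (intro sum.cong refl d_between)
  finally show ?thesis
    unfolding d_k d_b EXC_def by linarith
qed

theorem theorem3p5:
  fixes N k n :: nat and p t :: "nat \<Rightarrow> real"
  assumes "\<And>i. i \<in> {1..N} \<Longrightarrow> 0 \<le> p i \<and> p i \<le> 1"
    and "\<And>i. i \<in> {1..N} \<Longrightarrow> t i > 0"
    and "\<And>i. i \<in> {1..<N} \<Longrightarrow> p i / t i \<ge> p (i + 1) / t (i + 1)"
    and "k \<ge> 1" and "n \<ge> 1" and "k + n \<le> N" and "p k \<noteq> 1"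
  shows "expected_time N t p (exchange k (k + n) id) - expected_time N t p id \<le> EXC t p k n"
  using expected_time_exchange_eq_EXC[of k n N p t, OF assms(4-7)] by (rule eq_refl)

end
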